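(* Let $n\ge1$, let $X_1,\dots,X_n$ be iid uniform on $[0,1]$, $M_j=\min\{X_1,\dots,X_j\}$, and let $0\le b_1\le\cdots\le b_n\le1$ be arbitrary thresholds (not necessarily optimal). Let $$\tau=\min\{j\le n:\ X_j\le b_j,\ X_j=M_j\}.$$ Then the success probability of $\tau$ is $$\mathbb P(X_\tau=M_n)=\frac1n\Bigl[1-\sum_{j=1}^n(1-b_j)^n\Bigr]+\sum_{j=1}^{n-1}\sum_{i=1}^{j}\left[\frac{(1-b_i)^j}{j(n-j)}-\frac{(1-b_i)^n}{n(n-j)}\right].$$
   Context: If the set in the definition of $\tau$ is empty, no choice is made, and this counts as failure; thus $\mathbb P(X_\tau=M_n)$ means the probability that the set is nonempty and $X_\tau=M_n$. *)

theory Defs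
  imports "HOL-Probability.Probability"
begin

definition running_min :: "(nat \<Rightarrow> 'a \<Rightarrow> real) \<Rightarrow> nat \<Rightarrow> 'a \<Rightarrow> real" where
  "running_min X j \<omega> = Min ((\<lambda>i. X i \<omega>) ` {1..j})"

definition stop_set ::
  "(nat \<Rightarrow> 'a \<Rightarrow> real) \<Rightarrow> (nat \<Rightarrow> real) \<Rightarrow> nat \<Rightarrow> 'a \<Rightarrow> nat set" where
  "stop_set X b n \<omega> = {j \<in> {1..n}. X j \<omega> \<le> b j \<and> X j \<omega> = running_min X j \<omega>}"

(* Unspecified when stop_set is empty; success therefore requires nonemptiness explicitly. *)
definition stop_time ::
  "(nat \<Rightarrow> 'a \<Rightarrow> real) \<Rightarrow> (nat \<Rightarrow> real) \<Rightarrow> nat \<Rightarrow> 'a \<Rightarrow> nat" where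
  "stop_time X b n \<omega> = Min (stop_set X b n \<omega>)"

definition success ::
  "(nat \<Rightarrow> 'a \<Rightarrow> real) \<Rightarrow> (nat \<Rightarrow> real) \<Rightarrow> nat \<Rightarrow> 'a \<Rightarrow> bool" where
  "success X b n \<omega> \<longleftrightarrow>
     stop_set X b n \<omega> \<noteq> {} \<and> X (stop_time X b n \<omega>) \<omega> = running_min X n \<omega>"

end

theory Submission
  imports Defs
begin

text \<open>
The proof uses symmetry only; no density is integrated. The law of an iid family is invariant under
permutations (\<open>exchangeable\<close>), and ties occur with probability zero (\<open>AE_no_ties\<close>), so whenever
one of \<open>card T\<close> interchangeable indices must carry some unique mark, each carries it with probability
\<open>1 / card T\<close> times the probability that the mark exists (\<open>prob_equal_share\<close>). Two events are needed.

The index \<open>i \<in> S\<close> carries the minimum over \<open>S\<close>, with a value at most \<open>c\<close>: the minimum is at most \<open>c\<close>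
with probability \<open>1 - (1 - c) ^ card S\<close>, and its place is equidistributed (\<open>prob_strict_argmin\<close>).

The index \<open>i\<close> carries the minimum over \<open>S\<close> with a value at most \<open>c\<close>, but a still smaller value occurs
in a disjoint block \<open>T\<close>, whose minimum sits at \<open>k\<close>: summed over \<open>k\<close>, this is the difference of two
events of the first kind, for \<open>S\<close> and for \<open>S \<union> T\<close> (\<open>prob_two_block_argmin\<close>).

The rule succeeds exactly when the place \<open>k\<close> of the overall minimum satisfies \<open>X k \<le> b k\<close> and the
rule has not stopped before \<open>k\<close>. Since the thresholds never decrease, it has stopped before \<open>k\<close> if and only
if the place \<open>i\<close> of the minimum over \<open>{1..<k}\<close> satisfies \<open>X i \<le> b i\<close>: a stop at an earlier place with a
larger value would lie below a threshold that is no larger, so place \<open>i\<close> would pass its own threshold as well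
(\<open>success_iff_argmin\<close>). Subtracting these events for \<open>S = {1..<k}\<close> and \<open>T = {k..n}\<close> and summing over
\<open>k\<close> gives the formula, up to the rearrangement of sums in \<open>collect_sum\<close>.
\<close>

section \<open>Strict minimizers of a finite family\<close>


definition strict_argmin :: "('i \<Rightarrow> real) \<Rightarrow> 'i set \<Rightarrow> 'i \<Rightarrow> bool" where
  "strict_argmin x S i \<longleftrightarrow> i \<in> S \<and> (\<forall>l\<in>S - {i}. x i < x l)"

lemma strict_argmin_unique:
  assumes "strict_argmin x S i" "strict_argmin x S j"
  shows "i = j"
proof (rule ccontr)
  assume "i \<noteq> j"
  with assms have "x i < x j" "x j < x i"
    by (auto simp: strict_argmin_def)
  then show False by simp
qed

lemma strict_argmin_cong:
  assumes "\<And>l. l \<in> S \<Longrightarrow> x l = y l"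
  shows "strict_argmin x S i \<longleftrightarrow> strict_argmin y S i"
  using assms by (auto simp: strict_argmin_def)

lemma strict_argmin_restrict:
  "S \<subseteq> I \<Longrightarrow> strict_argmin (\<lambda>l\<in>I. x l) S i \<longleftrightarrow> strict_argmin x S i"
  by (intro strict_argmin_cong) auto

lemma strict_argmin_le: "strict_argmin x S i \<Longrightarrow> l \<in> S \<Longrightarrow> x i \<le> x l"
  by (cases "l = i") (auto simp: strict_argmin_def less_imp_le)

lemma ex_strict_argmin:
  assumes "finite S" "S \<noteq> {}" "inj_on x S"
  obtains i where "strict_argmin x S i"
proof -
  obtain i where i: "i \<in> S" "\<forall>l\<in>S. x i \<le> x l"
    using ex_is_arg_min_if_finite[of S x] assms(1,2) by (auto simp: is_arg_min_linorder)
  then have "strict_argmin x S i"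
    using assms(3) by (auto simp: strict_argmin_def inj_on_def order.strict_iff_order)
  then show thesis by (rule that)
qed

lemma strict_argmin_permutes:
  assumes "\<pi> permutes S"
  shows "strict_argmin (\<lambda>l. x (\<pi> l)) S i \<longleftrightarrow> strict_argmin x S (\<pi> i)"
proof -
  have inj: "inj \<pi>" using assms by (rule permutes_inj)
  have img: "\<pi> ` (S - {i}) = S - {\<pi> i}"
    using inj assms by (simp add: image_set_diff permutes_image)
  show ?thesis
    unfolding strict_argmin_def img[symmetric] using permutes_in_image[OF assms] by simp
qed

lemma strict_argmin_Un:
  "strict_argmin x (S \<union> T) i \<longleftrightarrow> strict_argmin x S i \<and> (\<forall>l\<in>T. x i < x l)"
  if "i \<in> S" "S \<inter> T = {}"
  using that by (auto simp: strict_argmin_def)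

lemma pred_strict_argmin [measurable]:
  assumes "finite S" "\<And>l. l \<in> S \<Longrightarrow> (\<lambda>\<omega>. X l \<omega>) \<in> borel_measurable N"
  shows "Measurable.pred N (\<lambda>\<omega>. strict_argmin (\<lambda>l. X l \<omega>) S i)"
proof (cases "i \<in> S")
  case True
  then show ?thesis
    unfolding strict_argmin_def using assms
    by (intro pred_intros_logic pred_intros_finite) (auto intro!: borel_measurable_pred_less)
qed (simp add: strict_argmin_def)

section \<open>Symmetry of independent families\<close>

lemma (in prob_space) prob_equal_share:
  assumes "finite T" "k \<in> T"
    and meas: "\<And>l. l \<in> T \<Longrightarrow> Measurable.pred M (E l)" "Measurable.pred M D"
    and eq: "\<And>l. l \<in> T \<Longrightarrow> prob {\<omega> \<in> space M. E l \<omega>} = prob {\<omega> \<in> space M. E k \<omega>}"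
    and disj: "\<And>l l' \<omega>. E l \<omega> \<Longrightarrow> E l' \<omega> \<Longrightarrow> l = l'"
    and D: "AE \<omega> in M. D \<omega> \<longleftrightarrow> (\<exists>l\<in>T. E l \<omega>)"
  shows "prob {\<omega> \<in> space M. E k \<omega>} = prob {\<omega> \<in> space M. D \<omega>} / card T"
proof -
  have s: "{\<omega> \<in> space M. E l \<omega>} \<in> events" if "l \<in> T" for l
    using meas(1)[OF that] by simp
  have "prob {\<omega> \<in> space M. D \<omega>} = prob (\<Union>l\<in>T. {\<omega> \<in> space M. E l \<omega>})"
    using D meas(2) s \<open>finite T\<close> by (intro measure_eq_AE) auto
  also have "\<dots> = (\<Sum>l\<in>T. prob {\<omega> \<in> space M. E l \<omega>})"
    using s \<open>finite T\<close> disj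
    by (intro finite_measure_finite_Union) (auto simp: disjoint_family_on_def)
  also have "\<dots> = card T * prob {\<omega> \<in> space M. E k \<omega>}"
    using eq by simp
  finally show ?thesis
    using assms(1,2) by (auto simp: field_simps)
qed

text \<open>Injectivity is essential: a repeated variable is not independent of itself. Permutations of the
  index set and the selection of two distinct indices are the instances of interest.\<close>

lemma (in prob_space) indep_vars_comp_inj:
  assumes indep: "indep_vars (\<lambda>_. N) X I" and f: "inj_on f K" "f ` K \<subseteq> I"
  shows "indep_vars (\<lambda>_. N) (\<lambda>k. X (f k)) K"
proof -
  let ?F = "\<lambda>i. {X i -` A \<inter> space M |A. A \<in> sets N}"
  have X: "\<forall>i\<in>I. random_variable N (X i)" and F: "indep_sets ?F I"
    using indep by (auto simp: indep_vars_def2)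
  have "indep_sets (\<lambda>k. ?F (f k)) K"
  proof (rule indep_setsI)
    show "?F (f k) \<subseteq> events" if "k \<in> K" for k
      using F f that by (auto simp: indep_sets_def)
    fix A J
    assume J: "J \<noteq> {}" "J \<subseteq> K" "finite J" and A: "\<forall>j\<in>J. A j \<in> ?F (f j)"
    have inj: "inj_on f J" using f(1) J(2) inj_on_subset by blast
    define A' where "A' = (\<lambda>i. A (the_inv_into J f i))"
    have A': "A' (f j) = A j" if "j \<in> J" for j
      using the_inv_into_f_f[OF inj that] by (simp add: A'_def)
    have "prob (\<Inter>i\<in>f ` J. A' i) = (\<Prod>i\<in>f ` J. prob (A' i))"
    proof (rule indep_setsD[OF F])
      show "f ` J \<subseteq> I" using J(2) f(2) by blast
    qed (use J A A' in auto)
    then show "prob (\<Inter>j\<in>J. A j) = (\<Prod>j\<in>J. prob (A j))"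
      using A' inj by (simp add: prod.reindex)
  qed
  then show ?thesis
    using X f by (auto simp: indep_vars_def2)
qed

section \<open>Independent uniform variables\<close>

locale iid_uniform = prob_space M for M :: "'a measure" +
  fixes X :: "'i \<Rightarrow> 'a \<Rightarrow> real" and I :: "'i set"
  assumes finite_I: "finite I"
    and indep: "indep_vars (\<lambda>_. borel) X I"
    and uniform: "\<And>i. i \<in> I \<Longrightarrow> distr M borel (X i) = uniform_measure lborel {0..1}"
begin

lemma X_measurable [measurable]: "i \<in> I \<Longrightarrow> X i \<in> borel_measurable M"
  using indep by (auto simp: indep_vars_def)

lemma prob_greater:
  assumes "i \<in> I" "0 \<le> c" "c \<le> 1"
  shows "prob {\<omega> \<in> space M. c < X i \<omega>} = 1 - c"
proof -
  have "prob {\<omega> \<in> space M. c < X i \<omega>} = measure (distr M borel (X i)) {c<..}"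
    using assms by (subst measure_distr) (auto intro!: arg_cong[of _ _ prob])
  also have "\<dots> = measure lborel {c<..1}"
  proof -
    have "{0..1} \<inter> {c<..} = {c<..1}" using assms by auto
    then show ?thesis
      by (simp add: uniform[OF assms(1)] measure_uniform_measure)
  qed
  also have "\<dots> = 1 - c"
    using assms by simp
  finally show ?thesis .
qed

lemma prob_all_greater:
  assumes "S \<subseteq> I" "0 \<le> c" "c \<le> 1"
  shows "prob {\<omega> \<in> space M. \<forall>l\<in>S. c < X l \<omega>} = (1 - c) ^ card S"
proof (cases "S = {}")
  case False
  have "finite S" using assms(1) finite_I by (rule finite_subset)
  have "prob {\<omega> \<in> space M. \<forall>l\<in>S. c < X l \<omega>} = prob (\<Inter>l\<in>S. X l -` {c<..} \<inter> space M)"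
    using False by (intro arg_cong[of _ _ prob]) auto
  also have "\<dots> = (\<Prod>l\<in>S. prob (X l -` {c<..} \<inter> space M))"
    using False \<open>finite S\<close> assms(1)
    by (intro indep_varsD[OF indep]) auto
  also have "\<dots> = (\<Prod>l\<in>S. 1 - c)"
    using assms prob_greater by (intro prod.cong) (auto simp: vimage_def Int_def conj_commute)
  finally show ?thesis by simp
qed (simp add: prob_space)

text \<open>By independence, the pair \<open>(X i, X j)\<close> has a product law; its diagonal is null because every section
  of the diagonal is a single point.\<close>

lemma AE_no_ties: "AE \<omega> in M. inj_on (\<lambda>i. X i \<omega>) I"
proof -
  have ne: "AE \<omega> in M. X i \<omega> \<noteq> X j \<omega>" if ij: "i \<in> I" "j \<in> I" "i \<noteq> j" for i j
  proof -
    let ?U = "uniform_measure lborel {0..1::real}"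
    interpret U: prob_space ?U by (intro prob_space_uniform_measure) auto
    have "indep_var borel (X i) borel (X j)"
    proof -
      have "indep_vars (\<lambda>_. borel) (\<lambda>k. X (case_bool i j k)) UNIV"
        using ij by (intro indep_vars_comp_inj[OF indep])
          (auto simp: inj_on_def split: bool.splits)
      moreover have "(\<lambda>k. X (case_bool i j k)) = case_bool (X i) (X j)"
        "(\<lambda>_. borel :: real measure) = case_bool borel borel"
        by (auto simp: fun_eq_iff split: bool.splits)
      ultimately show ?thesis by (simp add: indep_var_def)
    qed
    then have joint: "distr M (borel \<Otimes>\<^sub>M borel) (\<lambda>\<omega>. (X i \<omega>, X j \<omega>)) = ?U \<Otimes>\<^sub>M ?U"
      by (simp add: indep_var_distribution_eq uniform ij)
    have "Measurable.pred (borel \<Otimes>\<^sub>M borel) (\<lambda>p::real \<times> real. fst p = snd p)"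
      by measurable
    then have diag: "{p::real \<times> real. fst p = snd p} \<in> sets (borel \<Otimes>\<^sub>M borel)"
      by (simp add: pred_def space_pair_measure)
    have "emeasure (?U \<Otimes>\<^sub>M ?U) {p. fst p = snd p}
        = (\<integral>\<^sup>+x. emeasure ?U (Pair x -` {p. fst p = snd p}) \<partial>?U)"
      using diag by (intro U.emeasure_pair_measure_alt) (simp cong: sets_pair_measure_cong)
    also have "\<dots> = (\<integral>\<^sup>+x. 0 \<partial>?U)"
    proof (intro nn_integral_cong)
      fix x :: real
      have "Pair x -` {p. fst p = snd p} = {x}" by auto
      moreover have "emeasure lborel ({0..1} \<inter> {x}) \<le> emeasure lborel {x}"
        by (intro emeasure_mono) auto
      ultimately show "emeasure ?U (Pair x -` {p. fst p = snd p}) = 0"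
        by simp
    qed
    finally have "emeasure (distr M (borel \<Otimes>\<^sub>M borel) (\<lambda>\<omega>. (X i \<omega>, X j \<omega>))) {p. fst p = snd p} = 0"
      by (simp add: joint)
    then have "AE p in distr M (borel \<Otimes>\<^sub>M borel) (\<lambda>\<omega>. (X i \<omega>, X j \<omega>)). fst p \<noteq> snd p"
      by (intro AE_I[of _ _ "{p. fst p = snd p}"]) (use diag in auto)
    then show ?thesis
      using ij sets.compl_sets[OF diag]
      by (subst (asm) AE_distr_iff) (auto simp: Collect_neg_eq space_pair_measure Compl_eq_Diff_UNIV)
  qed
  have "AE \<omega> in M. \<forall>i\<in>I. \<forall>j\<in>I. i \<noteq> j \<longrightarrow> X i \<omega> \<noteq> X j \<omega>"
    using ne finite_I by (auto intro!: AE_finite_allI)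
  then show ?thesis
    by eventually_elim (auto simp: inj_on_def)
qed

text \<open>Both families have the same joint law, the product measure. Events are given by predicates on
  extensional functions because this is the carrier of the product measure.\<close>

lemma exchangeable:
  assumes \<pi>: "\<pi> permutes I"
    and P: "Measurable.pred (PiM I (\<lambda>_. borel)) P"
  shows "prob {\<omega> \<in> space M. P (\<lambda>i\<in>I. X (\<pi> i) \<omega>)} = prob {\<omega> \<in> space M. P (\<lambda>i\<in>I. X i \<omega>)}"
proof (cases "I = {}")
  case False
  let ?U = "uniform_measure lborel {0..1::real}"
  let ?law = "\<lambda>Y. distr M (PiM I (\<lambda>_. borel)) (\<lambda>\<omega>. \<lambda>i\<in>I. Y i \<omega>)"
  have law: "?law Y = PiM I (\<lambda>_. ?U)"
    if "indep_vars (\<lambda>_. borel) Y I" "\<And>i. i \<in> I \<Longrightarrow> distr M borel (Y i) = ?U"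
    for Y :: "'i \<Rightarrow> 'a \<Rightarrow> real"
  proof -
    have "?law Y = PiM I (\<lambda>i. distr M borel (Y i))"
      using that(1) by (subst indep_vars_iff_distr_eq_PiM'[OF False, symmetric])
        (auto simp: indep_vars_def)
    also have "\<dots> = PiM I (\<lambda>_. ?U)"
      using that(2) by (intro PiM_cong) auto
    finally show ?thesis .
  qed
  have "indep_vars (\<lambda>_. borel) (\<lambda>i. X (\<pi> i)) I"
    using \<pi> by (intro indep_vars_comp_inj[OF indep]) (simp_all add: permutes_image permutes_inj_on)
  moreover have "distr M borel (X (\<pi> i)) = ?U" if "i \<in> I" for i
    using that uniform permutes_in_image[OF \<pi>] by simp
  ultimately have eq: "?law (\<lambda>i. X (\<pi> i)) = ?law X"
    using law[of "\<lambda>i. X (\<pi> i)"] law[of X] indep uniform by simp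
  have pull: "prob {\<omega> \<in> space M. P (\<lambda>i\<in>I. Y i \<omega>)}
      = measure (?law Y) {x \<in> space (PiM I (\<lambda>_. borel)). P x}"
    if "\<And>i. i \<in> I \<Longrightarrow> Y i \<in> borel_measurable M" for Y
  proof -
    have "{x \<in> space (PiM I (\<lambda>_. borel)). P x} \<in> sets (PiM I (\<lambda>_. borel))"
      using P by (rule predE)
    then show ?thesis
      using that
      by (subst measure_distr) (auto intro!: arg_cong[of _ _ prob] measurable_restrict simp: space_PiM)
  qed
  show ?thesis
    using permutes_in_image[OF \<pi>] by (simp add: pull eq)
qed (simp add: restrict_def)

text \<open>Transpositions within \<open>S\<close> make all places of the minimum equally likely, and some place exists
  almost surely once the minimum is at most \<open>c\<close>.\<close>

lemma prob_strict_argmin: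
  assumes S: "S \<subseteq> I" "i \<in> S" and c: "0 \<le> c" "c \<le> 1"
  shows "prob {\<omega> \<in> space M. strict_argmin (\<lambda>l. X l \<omega>) S i \<and> X i \<omega> \<le> c}
    = (1 - (1 - c) ^ card S) / card S"
proof -
  let ?E = "\<lambda>l \<omega>. strict_argmin (\<lambda>l. X l \<omega>) S l \<and> X l \<omega> \<le> c"
  let ?D = "\<lambda>\<omega>. \<exists>l\<in>S. X l \<omega> \<le> c"
  have fin: "finite S" using S(1) finite_I by (rule finite_subset)
  have mD: "Measurable.pred M (\<lambda>\<omega>. \<forall>l\<in>S. c < X l \<omega>)"
    using fin S by (intro pred_intros_finite) auto
  have D_eq: "?D = (\<lambda>\<omega>. \<not> (\<forall>l\<in>S. c < X l \<omega>))"
    by (auto simp: fun_eq_iff not_less)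
  have "prob {\<omega> \<in> space M. ?E i \<omega>} = prob {\<omega> \<in> space M. ?D \<omega>} / card S"
  proof (rule prob_equal_share[OF fin S(2)])
    show "Measurable.pred M (?E l)" if "l \<in> S" for l
      using that S fin by (intro pred_intros_logic pred_strict_argmin) (auto)
    show "Measurable.pred M ?D" unfolding D_eq by (intro pred_intros_logic mD)
    show "prob {\<omega> \<in> space M. ?E l \<omega>} = prob {\<omega> \<in> space M. ?E i \<omega>}" if "l \<in> S" for l
    proof -
      define \<pi> where "\<pi> = Transposition.transpose i l"
      have \<pi>S: "\<pi> permutes S" and \<pi>i: "\<pi> i = l"
        using that S by (auto simp: \<pi>_def permutes_swap_id)
      then have \<pi>I: "\<pi> permutes I" using S(1) permutes_subset by blast
      have argmin_S: "strict_argmin (\<lambda>l. X (\<pi> l) \<omega>) S i \<longleftrightarrow> strict_argmin (\<lambda>l. X l \<omega>) S l" for \<omega>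
        using strict_argmin_permutes[OF \<pi>S, of "\<lambda>l. X l \<omega>" i] \<pi>i by simp
      have "Measurable.pred (PiM I (\<lambda>_. borel)) (\<lambda>x. strict_argmin x S i \<and> x i \<le> c)"
        using S fin by (intro pred_intros_logic pred_strict_argmin) auto
      from exchangeable[OF \<pi>I this] show ?thesis
        using S subsetD[OF S] \<pi>i
        by (simp add: strict_argmin_restrict argmin_S)
    qed
    show "l = l'" if "?E l \<omega>" "?E l' \<omega>" for l l' \<omega>
      using that strict_argmin_unique[of "\<lambda>l. X l \<omega>" S l l'] by simp
    show "AE \<omega> in M. ?D \<omega> \<longleftrightarrow> (\<exists>l\<in>S. ?E l \<omega>)"
      using AE_no_ties
    proof eventually_elim
      case (elim \<omega>)
      then have "inj_on (\<lambda>l. X l \<omega>) S" using S(1) inj_on_subset by blast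
      then obtain m where m: "strict_argmin (\<lambda>l. X l \<omega>) S m"
        using ex_strict_argmin fin S(2) by blast
      then have "m \<in> S" by (simp add: strict_argmin_def)
      moreover have "X m \<omega> \<le> c" if "l \<in> S" "X l \<omega> \<le> c" for l
        using strict_argmin_le[OF m that(1)] that(2) by simp
      ultimately show ?case using m by auto
    qed
  qed
  also have "prob {\<omega> \<in> space M. ?D \<omega>} = 1 - (1 - c) ^ card S"
    using prob_neg[OF mD[unfolded pred_def]] prob_all_greater[OF S(1) c] by (simp add: not_less)
  finally show ?thesis .
qed

text \<open>Transpositions within \<open>T\<close> leave the condition on \<open>S\<close> unchanged, so all places \<open>k\<close> are equally likely.
  Some place exists when \<open>i\<close> is minimal over \<open>S\<close> with value at most \<open>c\<close>, but no longer minimal over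
  \<open>S \<union> T\<close>; that probability is a difference of two instances of the preceding lemma.\<close>

lemma prob_two_block_argmin:
  assumes S: "S \<subseteq> I" "i \<in> S" and T: "T \<subseteq> I" "k \<in> T" and disj: "S \<inter> T = {}"
    and c: "0 \<le> c" "c \<le> 1"
  shows "prob {\<omega> \<in> space M. strict_argmin (\<lambda>l. X l \<omega>) S i \<and> X i \<omega> \<le> c
            \<and> strict_argmin (\<lambda>l. X l \<omega>) T k \<and> X k \<omega> < X i \<omega>}
    = ((1 - (1 - c) ^ card S) / card S - (1 - (1 - c) ^ (card S + card T)) / (card S + card T))
      / card T"
proof -
  let ?A = "\<lambda>S \<omega>. strict_argmin (\<lambda>l. X l \<omega>) S i \<and> X i \<omega> \<le> c"
  let ?E = "\<lambda>k \<omega>. strict_argmin (\<lambda>l. X l \<omega>) S i \<and> X i \<omega> \<le> c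
              \<and> strict_argmin (\<lambda>l. X l \<omega>) T k \<and> X k \<omega> < X i \<omega>"
  let ?D = "\<lambda>\<omega>. ?A S \<omega> \<and> \<not> ?A (S \<union> T) \<omega>"
  have fin: "finite S" "finite T" using S T finite_I finite_subset by blast+
  have mA: "Measurable.pred M (?A R)" if "R \<subseteq> I" for R
    using S that finite_subset[OF that finite_I]
    by (intro pred_intros_logic pred_strict_argmin) auto
  have "prob {\<omega> \<in> space M. ?E k \<omega>} = prob {\<omega> \<in> space M. ?D \<omega>} / card T"
  proof (rule prob_equal_share[OF fin(2) T(2)])
    show "Measurable.pred M (?E l)" if "l \<in> T" for l
      using that S T fin
      by (intro pred_intros_logic pred_strict_argmin borel_measurable_pred_less) auto
    show "Measurable.pred M ?D"
      using S T fin by (intro pred_intros_logic pred_strict_argmin) auto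
    show "prob {\<omega> \<in> space M. ?E l \<omega>} = prob {\<omega> \<in> space M. ?E k \<omega>}" if "l \<in> T" for l
    proof -
      define \<pi> where "\<pi> = Transposition.transpose k l"
      have \<pi>T: "\<pi> permutes T" and \<pi>k: "\<pi> k = l"
        using that T by (auto simp: \<pi>_def permutes_swap_id)
      then have \<pi>I: "\<pi> permutes I" using T(1) permutes_subset by blast
      have \<pi>S: "\<pi> m = m" if "m \<in> S" for m
        using that \<pi>T disj by (auto simp: permutes_def)
      have argmin_S: "strict_argmin (\<lambda>l. X (\<pi> l) \<omega>) S i \<longleftrightarrow> strict_argmin (\<lambda>l. X l \<omega>) S i" for \<omega>
        by (intro strict_argmin_cong) (simp add: \<pi>S)
      have argmin_T: "strict_argmin (\<lambda>l. X (\<pi> l) \<omega>) T k \<longleftrightarrow> strict_argmin (\<lambda>l. X l \<omega>) T l" for \<omega>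
        using strict_argmin_permutes[OF \<pi>T, of "\<lambda>l. X l \<omega>" k] \<pi>k by simp
      have "Measurable.pred (PiM I (\<lambda>_. borel)) (\<lambda>x. strict_argmin x S i \<and> x i \<le> c
              \<and> strict_argmin x T k \<and> x k < x i)"
        using S T fin
        by (intro pred_intros_logic pred_strict_argmin borel_measurable_pred_less) auto
      from exchangeable[OF \<pi>I this] show ?thesis
        using S T subsetD[OF S] subsetD[OF T] \<pi>S[OF S(2)]
        by (simp add: strict_argmin_restrict argmin_S argmin_T \<pi>k)
    qed
    show "l = l'" if "?E l \<omega>" "?E l' \<omega>" for l l' \<omega>
      using that strict_argmin_unique[of "\<lambda>l. X l \<omega>" T l l'] by simp
    show "AE \<omega> in M. ?D \<omega> \<longleftrightarrow> (\<exists>l\<in>T. ?E l \<omega>)"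
      using AE_no_ties
    proof eventually_elim
      case (elim \<omega>)
      then have inj: "inj_on (\<lambda>l. X l \<omega>) T" using T(1) inj_on_subset by blast
      then obtain m where m: "strict_argmin (\<lambda>l. X l \<omega>) T m"
        using ex_strict_argmin fin T(2) by blast
      then have mT: "m \<in> T" by (simp add: strict_argmin_def)
      then have m_iff: "strict_argmin (\<lambda>l. X l \<omega>) T l \<longleftrightarrow> l = m" for l
        using m strict_argmin_unique[OF m] by blast
      have "m \<noteq> i" using mT S(2) disj by auto
      then have "X i \<omega> \<noteq> X m \<omega>"
        using inj_onD[OF elim, of i m] S T mT by auto
      then have "(\<forall>l\<in>T. X i \<omega> < X l \<omega>) \<longleftrightarrow> \<not> X m \<omega> < X i \<omega>"
        using mT strict_argmin_le[OF m] by force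
      then show ?case
        using mT by (auto simp: m_iff strict_argmin_Un[OF S(2) disj])
    qed
  qed
  also have "prob {\<omega> \<in> space M. ?D \<omega>}
      = prob ({\<omega> \<in> space M. ?A S \<omega>} - {\<omega> \<in> space M. ?A (S \<union> T) \<omega>})"
    by (intro arg_cong[of _ _ prob]) auto
  also have "\<dots> = prob {\<omega> \<in> space M. ?A S \<omega>} - prob {\<omega> \<in> space M. ?A (S \<union> T) \<omega>}"
    using mA[of S] mA[of "S \<union> T"] S T
    by (intro finite_measure_Diff) (auto simp: strict_argmin_Un[OF S(2) disj])
  also have "\<dots> = (1 - (1 - c) ^ card S) / card S
      - (1 - (1 - c) ^ (card S + card T)) / (card S + card T)"
    using S T c fin disj by (simp add: prob_strict_argmin card_Un_disjoint)
  finally show ?thesis .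
qed

end

section \<open>The success event\<close>

lemma strict_argmin_iff_le:
  assumes "inj_on x S"
  shows "strict_argmin x S i \<longleftrightarrow> i \<in> S \<and> (\<forall>l\<in>S. x i \<le> x l)"
  using assms by (auto simp: strict_argmin_def inj_on_def order.strict_iff_order)

lemma mem_stop_set_iff:
  "j \<in> stop_set X b n \<omega> \<longleftrightarrow> j \<in> {1..n} \<and> X j \<omega> \<le> b j \<and> (\<forall>l\<in>{1..j}. X j \<omega> \<le> X l \<omega>)"
proof (cases "j \<in> {1..n}")
  case True
  then have "X j \<omega> = running_min X j \<omega> \<longleftrightarrow> (\<forall>l\<in>{1..j}. X j \<omega> \<le> X l \<omega>)"
    unfolding running_min_def by (subst eq_commute, subst Min_eq_iff) auto
  then show ?thesis using True by (simp add: stop_set_def)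
qed (auto simp: stop_set_def)

text \<open>No assumption on ties or on the thresholds is made here, so this form also shows that the success
  event is measurable; the later description is valid only almost surely.\<close>

lemma success_iff:
  "success X b n \<omega> \<longleftrightarrow> (\<exists>k\<in>{1..n}. (\<forall>l\<in>{1..n}. X k \<omega> \<le> X l \<omega>) \<and> X k \<omega> \<le> b k
      \<and> \<not> (\<exists>i\<in>{1..<k}. (\<forall>l\<in>{1..i}. X i \<omega> \<le> X l \<omega>) \<and> X i \<omega> \<le> b i))"
  (is "_ \<longleftrightarrow> ?R")
proof
  let ?S = "stop_set X b n \<omega>" and ?k = "stop_time X b n \<omega>"
  have fin: "finite ?S" by (simp add: stop_set_def)
  have min: "X k \<omega> = running_min X n \<omega> \<longleftrightarrow> (\<forall>l\<in>{1..n}. X k \<omega> \<le> X l \<omega>)" if "k \<in> {1..n}" for k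
    unfolding running_min_def using that by (subst eq_commute, subst Min_eq_iff) auto
  show ?R if "success X b n \<omega>"
  proof -
    have ne: "?S \<noteq> {}" and eq: "X ?k \<omega> = running_min X n \<omega>"
      using that by (auto simp: success_def)
    have k: "?k \<in> ?S" using fin ne by (simp add: stop_time_def)
    have first: "i \<notin> ?S" if "i < ?k" for i
    proof
      assume "i \<in> ?S"
      then have "?k \<le> i" using fin by (simp add: stop_time_def)
      then show False using that by simp
    qed
    have kn: "?k \<in> {1..n}" "X ?k \<omega> \<le> b ?k" using k by (auto simp: mem_stop_set_iff)
    have "\<not> ((\<forall>l\<in>{1..i}. X i \<omega> \<le> X l \<omega>) \<and> X i \<omega> \<le> b i)" if "i \<in> {1..<?k}" for i
      using first[of i] that kn(1) by (auto simp: mem_stop_set_iff)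
    then show ?R using kn eq min[OF kn(1)] by blast
  qed
  show "success X b n \<omega>" if ?R
  proof -
    obtain k where k: "k \<in> {1..n}" "\<forall>l\<in>{1..n}. X k \<omega> \<le> X l \<omega>" "X k \<omega> \<le> b k"
      and first: "\<And>i. i \<in> {1..<k} \<Longrightarrow> \<not> ((\<forall>l\<in>{1..i}. X i \<omega> \<le> X l \<omega>) \<and> X i \<omega> \<le> b i)"
      using \<open>?R\<close> by blast
    have kS: "k \<in> ?S" using k by (auto simp: mem_stop_set_iff)
    have "k \<le> i" if "i \<in> ?S" for i
      using first[of i] that by (force simp: mem_stop_set_iff)
    then have "?k = k" using fin kS by (auto simp: stop_time_def intro: Min_eqI)
    then show ?thesis using kS k min[OF k(1)] by (auto simp: success_def)
  qed
qed

text \<open>Having stopped before \<open>k\<close> depends only on the place of the minimum over \<open>{1..<k}\<close>. This is where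
  monotonicity of the thresholds enters.\<close>

lemma success_iff_argmin:
  assumes inj: "inj_on (\<lambda>l. X l \<omega>) {1..n}" and b: "mono_on {1..n} b"
  shows "success X b n \<omega> \<longleftrightarrow> (\<exists>k\<in>{1..n}. strict_argmin (\<lambda>l. X l \<omega>) {1..n} k \<and> X k \<omega> \<le> b k
      \<and> \<not> (\<exists>i\<in>{1..<k}. strict_argmin (\<lambda>l. X l \<omega>) {1..<k} i \<and> X i \<omega> \<le> b i))"
proof -
  let ?m = "strict_argmin (\<lambda>l. X l \<omega>)"
  have "(\<exists>i\<in>{1..<k}. (\<forall>l\<in>{1..i}. X i \<omega> \<le> X l \<omega>) \<and> X i \<omega> \<le> b i)
      \<longleftrightarrow> (\<exists>i\<in>{1..<k}. ?m {1..<k} i \<and> X i \<omega> \<le> b i)" (is "?L \<longleftrightarrow> ?R") if k: "k \<in> {1..n}" for k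
  proof
    assume ?L
    then obtain i where i: "i \<in> {1..<k}" "\<forall>l\<in>{1..i}. X i \<omega> \<le> X l \<omega>" "X i \<omega> \<le> b i" by blast
    have inj': "inj_on (\<lambda>l. X l \<omega>) {1..<k}" using k by (auto intro: inj_on_subset[OF inj])
    then obtain m where m: "?m {1..<k} m" using ex_strict_argmin i(1) by blast
    then have mk: "m \<in> {1..<k}" and le: "X m \<omega> \<le> X i \<omega>"
      using strict_argmin_le[OF m i(1)] by (auto simp: strict_argmin_def)
    \<comment> \<open>As \<open>i\<close> is a record, the minimum before \<open>k\<close> is attained at \<open>i\<close> or later, under a larger threshold.\<close>
    have "i \<le> m"
    proof (rule ccontr)
      assume "\<not> i \<le> m"
      then have "X m \<omega> = X i \<omega>" using i(2) le mk by (auto intro: antisym)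
      then show False using inj_onD[OF inj', of m i] i(1) mk \<open>\<not> i \<le> m\<close> by auto
    qed
    then have "b i \<le> b m" using b i(1) mk k by (auto simp: mono_on_def)
    then show ?R using m mk le i(3) by force
  next
    assume ?R
    then obtain i where i: "i \<in> {1..<k}" "?m {1..<k} i" "X i \<omega> \<le> b i" by blast
    then have "\<forall>l\<in>{1..i}. X i \<omega> \<le> X l \<omega>" using strict_argmin_le[OF i(2)] by auto
    then show ?L using i(1,3) by blast
  qed
  then show ?thesis
    unfolding success_iff using strict_argmin_iff_le[OF inj] by auto
qed

section \<open>Summation\<close>

text \<open>In \<open>1 / (n - j) * (1 / j - 1 / n) = 1 / (j * n)\<close> the factor \<open>n - j\<close> cancels, so the constant parts
  of the inner sums add up to \<open>(n - 1) / n\<close>; this leaves the \<open>1 / n\<close> of the result. The outer index is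
  \<open>j = k - 1\<close>, the size of the first block, and the empty block \<open>k = 1\<close> contributes nothing.\<close>

lemma collect_sum:
  fixes a :: "nat \<Rightarrow> real"
  assumes "n \<ge> 1"
  shows "(\<Sum>k=1..n. (1 - a k ^ n) / real n
            - (\<Sum>i\<in>{1..<k}. ((1 - a i ^ (k - 1)) / real (k - 1) - (1 - a i ^ n) / real n) / real (n + 1 - k)))
    = 1 / real n * (1 - (\<Sum>j=1..n. a j ^ n))
      + (\<Sum>j=1..n-1. \<Sum>i=1..j.
           a i ^ j / (real j * (real n - real j)) - a i ^ n / (real n * (real n - real j)))"
    (is "(\<Sum>k=1..n. _ k - (\<Sum>i\<in>{1..<k}. ?g k i)) = _ + ?R")
proof -
  obtain m where n: "n = Suc m" using assms by (cases n) auto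
  have shift: "(\<Sum>k=1..n. h k) = h 1 + (\<Sum>j=1..n-1. h (Suc j))" for h :: "nat \<Rightarrow> real"
    using sum.atLeast_Suc_atMost[of 1 n h] sum.shift_bounds_cl_Suc_ivl[of h 1 m] by (simp add: n)
  have "(\<Sum>k=1..n. \<Sum>i\<in>{1..<k}. ?g k i) = (\<Sum>j=1..n-1. \<Sum>i\<in>{1..<Suc j}. ?g (Suc j) i)"
    by (subst shift) simp
  also have "\<dots> = (\<Sum>j=1..n-1. 1 / real n
      - (\<Sum>i=1..j. a i ^ j / (real j * (real n - real j)) - a i ^ n / (real n * (real n - real j))))"
  proof (intro sum.cong refl)
    fix j assume j: "j \<in> {1..n-1}"
    then have pos: "real j > 0" "real n > 0" "real n - real j > 0" "real (n + 1 - Suc j) = real n - real j"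
      by auto
    have "?g (Suc j) i = 1 / (real j * real n)
        - (a i ^ j / (real j * (real n - real j)) - a i ^ n / (real n * (real n - real j)))" for i
      unfolding pos(4) using pos(1-3) by (simp add: divide_simps) (simp add: algebra_simps)
    then have "(\<Sum>i\<in>{1..<Suc j}. ?g (Suc j) i) = (\<Sum>i=1..j. 1 / (real j * real n)
        - (a i ^ j / (real j * (real n - real j)) - a i ^ n / (real n * (real n - real j))))"
      by (simp add: atLeastLessThanSuc_atLeastAtMost)
    then show "(\<Sum>i\<in>{1..<Suc j}. ?g (Suc j) i) = 1 / real n
      - (\<Sum>i=1..j. a i ^ j / (real j * (real n - real j)) - a i ^ n / (real n * (real n - real j)))"
      using pos(1) by (simp add: sum_subtractf)
  qed
  also have "\<dots> = real (n - 1) / real n - ?R"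
    by (subst sum_subtractf) simp
  finally have *: "(\<Sum>k=1..n. \<Sum>i\<in>{1..<k}. ?g k i) = real (n - 1) / real n - ?R" .
  have "(\<Sum>k=1..n. (1 - a k ^ n) / real n) = 1 - (\<Sum>k=1..n. a k ^ n) / real n"
    using assms by (simp add: sum_divide_distrib[symmetric] sum_subtractf diff_divide_distrib)
  moreover have "real (n - 1) / real n = 1 - 1 / real n"
    using assms by (simp add: n field_simps)
  ultimately have "(\<Sum>k=1..n. (1 - a k ^ n) / real n - (\<Sum>i\<in>{1..<k}. ?g k i))
      = (1 - (\<Sum>k=1..n. a k ^ n) / real n) - ((1 - 1 / real n) - ?R)"
    using * by (simp only: sum_subtractf)
  also have "\<dots> = 1 / real n * (1 - (\<Sum>j=1..n. a j ^ n)) + ?R"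
    by (simp add: right_diff_distrib)
  finally show ?thesis .
qed

section \<open>The success probability\<close>

theorem mainTheorem3:
  fixes M :: "'a measure" and X :: "nat \<Rightarrow> 'a \<Rightarrow> real" and b :: "nat \<Rightarrow> real" and n :: nat
  assumes "prob_space M"
    and "n \<ge> 1"
    and "prob_space.indep_vars M (\<lambda>_. borel) X {1..n}"
    and "\<And>i. i \<in> {1..n} \<Longrightarrow> distr M lborel (X i) = uniform_measure lborel {0..1}"
    and "0 \<le> b 1" and "mono_on {1..n} b" and "b n \<le> 1"
  shows "measure M {\<omega> \<in> space M. success X b n \<omega>} =
      1 / real n * (1 - (\<Sum>j=1..n. (1 - b j) ^ n))
      + (\<Sum>j=1..n-1. \<Sum>i=1..j.
           (1 - b i) ^ j / (real j * (real n - real j))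
           - (1 - b i) ^ n / (real n * (real n - real j)))"
proof -
  interpret prob_space M by fact
  interpret iid_uniform M X "{1..n}"
  proof
    show "distr M borel (X i) = uniform_measure lborel {0..1}" if "i \<in> {1..n}" for i
    proof -
      have "distr M borel (X i) = distr M lborel (X i)"
        by (intro distr_cong) auto
      then show ?thesis using assms(4)[OF that] by simp
    qed
  qed (use assms(3) in simp_all)
  have b: "0 \<le> b i" "b i \<le> 1" if "i \<in> {1..n}" for i
    using mono_onD[OF assms(6), of 1 i] mono_onD[OF assms(6), of i n] that assms(5,7) by auto
  have b_mono: "b i \<le> b k" if "i \<in> {1..<k}" "k \<in> {1..n}" for i k
    using mono_onD[OF assms(6), of i k] that by auto
  let ?m = "\<lambda>\<omega>. strict_argmin (\<lambda>l. X l \<omega>)"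
  \<comment> \<open>\<open>A k\<close>: accepting \<open>k\<close> would be correct; \<open>B k i\<close>: it would be, but the rule has stopped before \<open>k\<close>,
    \<open>i\<close> being the place of the earlier minimum; \<open>E k\<close>: the rule succeeds at \<open>k\<close>.\<close>
  define A where "A k \<omega> \<longleftrightarrow> ?m \<omega> {1..n} k \<and> X k \<omega> \<le> b k" for k \<omega>
  define B where "B k i \<omega> \<longleftrightarrow> ?m \<omega> {1..<k} i \<and> X i \<omega> \<le> b i \<and> ?m \<omega> {k..n} k \<and> X k \<omega> < X i \<omega>" for k i \<omega>
  define E where "E k \<omega> \<longleftrightarrow> A k \<omega> \<and> \<not> (\<exists>i\<in>{1..<k}. B k i \<omega>)" for k \<omega>
  have E_unique: "k = l" if "E k \<omega>" "E l \<omega>" for k l \<omega>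
    using that strict_argmin_unique[of "\<lambda>l. X l \<omega>" "{1..n}" k l] by (simp add: E_def A_def)
  have B_unique: "i = j" if "B k i \<omega>" "B k j \<omega>" for k i j \<omega>
    using that strict_argmin_unique[of "\<lambda>l. X l \<omega>" "{1..<k}" i j] by (simp add: B_def)
  have A_meas: "Measurable.pred M (A k)" if "k \<in> {1..n}" for k
    unfolding A_def using that by (intro pred_intros_logic pred_strict_argmin) auto
  have B_meas: "Measurable.pred M (B k i)" if "k \<in> {1..n}" "i \<in> {1..<k}" for k i
    unfolding B_def using that
    by (intro pred_intros_logic pred_strict_argmin borel_measurable_pred_less) auto
  have E_meas: "Measurable.pred M (E k)" if "k \<in> {1..n}" for k
    unfolding E_def using that A_meas B_meas
    by (intro pred_intros_logic pred_intros_finite) auto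
  have success_meas: "Measurable.pred M (success X b n)"
    unfolding success_iff
    by (intro pred_intros_logic pred_intros_finite borel_measurable_pred_less) auto
  \<comment> \<open>In \<open>B k i\<close> the condition \<open>X k \<le> b k\<close> is absent: it follows from \<open>X k < X i \<le> b i \<le> b k\<close>. This puts
    the event into the two-block form.\<close>
  have AB: "A k \<omega> \<and> ?m \<omega> {1..<k} i \<and> X i \<omega> \<le> b i \<longleftrightarrow> B k i \<omega>"
    if k: "k \<in> {1..n}" and i: "i \<in> {1..<k}" for k i \<omega>
  proof -
    have split: "{1..n} = {k..n} \<union> {1..<k}" and dj: "k \<in> {k..n}" "{k..n} \<inter> {1..<k} = {}"
      using k by auto
    have "?m \<omega> {1..n} k \<longleftrightarrow> ?m \<omega> {k..n} k \<and> (\<forall>l\<in>{1..<k}. X k \<omega> < X l \<omega>)"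
      unfolding split by (rule strict_argmin_Un[OF dj])
    moreover have "(\<forall>l\<in>{1..<k}. X k \<omega> < X l \<omega>) \<longleftrightarrow> X k \<omega> < X i \<omega>" if "?m \<omega> {1..<k} i"
      using strict_argmin_le[OF that] i by force
    ultimately show ?thesis
      using b_mono[OF i k] by (auto simp: A_def B_def)
  qed
  have "measure M {\<omega> \<in> space M. success X b n \<omega>} = prob (\<Union>k\<in>{1..n}. {\<omega> \<in> space M. E k \<omega>})"
  proof (rule measure_eq_AE)
    show "AE \<omega> in M. \<omega> \<in> {\<omega> \<in> space M. success X b n \<omega>}
        \<longleftrightarrow> \<omega> \<in> (\<Union>k\<in>{1..n}. {\<omega> \<in> space M. E k \<omega>})"
      using AE_no_ties
    proof eventually_elim
      case (elim \<omega>)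
      have "(?m \<omega> {1..n} k \<and> X k \<omega> \<le> b k
            \<and> \<not> (\<exists>i\<in>{1..<k}. ?m \<omega> {1..<k} i \<and> X i \<omega> \<le> b i)) \<longleftrightarrow> E k \<omega>"
        if k: "k \<in> {1..n}" for k
      proof (cases "A k \<omega>")
        case True
        then have "(\<exists>i\<in>{1..<k}. ?m \<omega> {1..<k} i \<and> X i \<omega> \<le> b i) \<longleftrightarrow> (\<exists>i\<in>{1..<k}. B k i \<omega>)"
          using AB[OF k, of _ \<omega>] by (intro bex_cong) simp_all
        then show ?thesis using True by (simp add: E_def A_def)
      qed (auto simp: E_def A_def)
      then have "success X b n \<omega> \<longleftrightarrow> (\<exists>k\<in>{1..n}. E k \<omega>)"
        unfolding success_iff_argmin[of X \<omega> n b, OF elim assms(6)] by (intro bex_cong) simp_all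
      then show ?case by auto
    qed
  qed (use success_meas E_meas in auto)
  also have "\<dots> = (\<Sum>k=1..n. prob {\<omega> \<in> space M. E k \<omega>})"
    using E_meas E_unique
    by (intro finite_measure_finite_Union) (auto simp: disjoint_family_on_def)
  also have "\<dots> = (\<Sum>k=1..n. (1 - (1 - b k) ^ n) / real n
      - (\<Sum>i\<in>{1..<k}. ((1 - (1 - b i) ^ (k - 1)) / real (k - 1) - (1 - (1 - b i) ^ n) / real n)
          / real (n + 1 - k)))"
  proof (intro sum.cong refl)
    fix k assume k: "k \<in> {1..n}"
    have "prob {\<omega> \<in> space M. E k \<omega>}
        = prob ({\<omega> \<in> space M. A k \<omega>} - (\<Union>i\<in>{1..<k}. {\<omega> \<in> space M. B k i \<omega>}))"
      by (intro arg_cong[of _ _ prob]) (auto simp: E_def)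
    also have "\<dots> = prob {\<omega> \<in> space M. A k \<omega>} - prob (\<Union>i\<in>{1..<k}. {\<omega> \<in> space M. B k i \<omega>})"
      using A_meas[OF k] B_meas[OF k] AB[OF k]
      by (intro finite_measure_Diff sets.finite_UN) (auto simp del: atLeastLessThan_iff)
    also have "prob (\<Union>i\<in>{1..<k}. {\<omega> \<in> space M. B k i \<omega>})
        = (\<Sum>i\<in>{1..<k}. prob {\<omega> \<in> space M. B k i \<omega>})"
      using B_meas[OF k] B_unique
      by (intro finite_measure_finite_Union) (auto simp: disjoint_family_on_def)
    also have "\<dots> = (\<Sum>i\<in>{1..<k}. ((1 - (1 - b i) ^ (k - 1)) / real (k - 1)
        - (1 - (1 - b i) ^ n) / real n) / real (n + 1 - k))"
    proof (intro sum.cong refl)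
      fix i assume i: "i \<in> {1..<k}"
      have "card {1..<k} + card {k..n} = n" "real (card {1..<k}) + real (card {k..n}) = real n"
        using k by auto
      then show "prob {\<omega> \<in> space M. B k i \<omega>} = ((1 - (1 - b i) ^ (k - 1)) / real (k - 1)
          - (1 - (1 - b i) ^ n) / real n) / real (n + 1 - k)"
        unfolding B_def using k i b[of i]
        by (subst prob_two_block_argmin) (auto simp: Suc_diff_le)
    qed
    also have "prob {\<omega> \<in> space M. A k \<omega>} = (1 - (1 - b k) ^ n) / real n"
      unfolding A_def using k b[OF k] by (subst prob_strict_argmin) auto
    finally show "prob {\<omega> \<in> space M. E k \<omega>} = (1 - (1 - b k) ^ n) / real n
      - (\<Sum>i\<in>{1..<k}. ((1 - (1 - b i) ^ (k - 1)) / real (k - 1) - (1 - (1 - b i) ^ n) / real n)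
          / real (n + 1 - k))" .
  qed
  also have "\<dots> = 1 / real n * (1 - (\<Sum>j=1..n. (1 - b j) ^ n))
      + (\<Sum>j=1..n-1. \<Sum>i=1..j.
           (1 - b i) ^ j / (real j * (real n - real j))
           - (1 - b i) ^ n / (real n * (real n - real j)))"
    using assms(2) by (rule collect_sum)
  finally show ?thesis .
qed

end
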